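(* There is an absolute constant $C>0$ such that for every integer $d\ge 1$, $$N_d(1)\ge C\cdot 2^{d/2}.$$
   Context: A nice measure on $\mathbb{R}^d$ is a finite nonzero Borel measure that has a continuous, everywhere strictly positive density with respect to Lebesgue measure. A convex partition of $\mathbb{R}^d$ into $n$ parts is a covering of $\mathbb{R}^d$ by $n$ closed convex sets (possibly unbounded, with nonempty interior) whose interiors are pairwise disjoint. An (affine) hyperplane avoids a set $C$ if it does not intersect the interior of $C$. $N_d(k)$ denotes the smallest positive integer $n$ such that for every nice measure $\mu$ on $\mathbb{R}^d$ there exists a convex partition of $\mathbb{R}^d$ into $n$ parts of equal $\mu$-measure such that every hyperplane avoids at least $k$ of the parts. *)

theory Defs
  imports "HOL-Analysis.Analysis"
begin

text \<open>
  The space $\mathbb{R}^d$ is represented by the extensional functions on \<open>{..<d}\<close>, which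
  allows the dimension to be quantified inside a formula.
\<close>

abbreviation space_top :: "nat \<Rightarrow> (nat \<Rightarrow> real) topology" where
  "space_top d \<equiv> product_topology (\<lambda>_. euclideanreal) {..<d}"

abbreviation lebesgue_product :: "nat \<Rightarrow> (nat \<Rightarrow> real) measure" where
  "lebesgue_product d \<equiv> Pi\<^sub>M {..<d} (\<lambda>_. lborel)"

text \<open>The measurable sets of the product measure are the Borel sets of the product topology.\<close>

lemma openin_space_top_measurable:
  assumes "openin (space_top d) U"
  shows "U \<in> sets (lebesgue_product d)"
proof -
  obtain B :: "real set set" where B: "countable B" "topological_basis B"
    using ex_countable_basis by blast
  define F where "F = {W \<in> Pi\<^sub>E {..<d} ` (Pi\<^sub>E {..<d} (\<lambda>_. B)). W \<subseteq> U}"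
  have "countable F"
    unfolding F_def using B(1)
    by (intro countable_subset[OF Collect_restrict] countable_image countable_PiE) auto
  moreover have "W \<in> sets (lebesgue_product d)" if W: "W \<in> F" for W
  proof -
    obtain V where V: "W = Pi\<^sub>E {..<d} V" "V \<in> Pi\<^sub>E {..<d} (\<lambda>_. B)"
      using W unfolding F_def by blast
    have "V i \<in> sets lborel" if "i \<in> {..<d}" for i
    proof -
      have "V i \<in> B" using V(2) that by (rule PiE_mem)
      then show ?thesis using topological_basis_open[OF B(2)] by simp
    qed
    then show ?thesis unfolding V(1) by (intro sets_PiM_I_finite) auto
  qed
  moreover have "U = \<Union>F"
  proof
    show "U \<subseteq> \<Union>F"
    proof
      fix x assume "x \<in> U"
      then obtain V where V: "\<And>i. i \<in> {..<d} \<Longrightarrow> open (V i)"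
          "x \<in> Pi\<^sub>E {..<d} V" "Pi\<^sub>E {..<d} V \<subseteq> U"
        using assms unfolding openin_product_topology_alt by (metis open_openin)
      have "\<exists>b\<in>B. x i \<in> b \<and> b \<subseteq> V i" if i: "i \<in> {..<d}" for i
      proof -
        have "x i \<in> V i" using V(2) i by (rule PiE_mem)
        with V(1)[OF i] B(2) show ?thesis by (meson topological_basisE)
      qed
      then obtain b where b: "\<And>i. i \<in> {..<d} \<Longrightarrow> b i \<in> B \<and> x i \<in> b i \<and> b i \<subseteq> V i"
        by metis
      let ?b = "restrict b {..<d}"
      have "Pi\<^sub>E {..<d} ?b \<subseteq> U"
      proof -
        have "Pi\<^sub>E {..<d} ?b \<subseteq> Pi\<^sub>E {..<d} V" using b by (intro PiE_mono) auto
        with V(3) show ?thesis by blast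
      qed
      moreover have "?b \<in> Pi\<^sub>E {..<d} (\<lambda>_. B)" using b by auto
      ultimately have "Pi\<^sub>E {..<d} ?b \<in> F" unfolding F_def by blast
      moreover have "x \<in> Pi\<^sub>E {..<d} ?b"
        using V(2) b by (intro PiE_I) (auto simp: PiE_def extensional_def)
      ultimately show "x \<in> \<Union>F" by blast
    qed
  qed (auto simp: F_def)
  ultimately show ?thesis
    by (metis sets.countable_Union subsetI)
qed

lemma sets_lebesgue_product:
  "sets (lebesgue_product d)
    = sigma_sets (topspace (space_top d)) {U. openin (space_top d) U}" (is "_ = ?S")
proof
  let ?N = "sigma (topspace (space_top d)) {U. openin (space_top d) U}"
  have sub: "{U. openin (space_top d) U} \<subseteq> Pow (topspace (space_top d))"
    using openin_subset by blast
  have sp: "space (lebesgue_product d) = topspace (space_top d)"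
    by (simp add: space_PiM)
  show "?S \<subseteq> sets (lebesgue_product d)"
    unfolding sp[symmetric]
    by (intro sets.sigma_sets_subset) (auto intro: openin_space_top_measurable)
  have comp: "(\<lambda>x. x i) \<in> borel_measurable ?N" if i: "i \<in> {..<d}" for i
  proof (rule borel_measurableI)
    fix S :: "real set" assume "open S"
    moreover have "continuous_map (space_top d) euclideanreal (\<lambda>x. x i)"
      using i by (rule continuous_map_product_projection)
    ultimately have "openin (space_top d) {x \<in> topspace (space_top d). x i \<in> S}"
      by (auto simp: continuous_map_def)
    moreover have "(\<lambda>x. x i) -` S \<inter> space ?N = {x \<in> topspace (space_top d). x i \<in> S}"
      using sub by (auto simp: space_measure_of_conv)
    ultimately show "(\<lambda>x. x i) -` S \<inter> space ?N \<in> sets ?N"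
      using sub by (simp add: sets_measure_of)
  qed
  have "(\<lambda>x. x) \<in> measurable ?N (lebesgue_product d)"
  proof (rule measurable_PiM_single'[where f = "\<lambda>i x. x i"])
    show "(\<lambda>x. x i) \<in> measurable ?N lborel" if "i \<in> {..<d}" for i
      using comp[OF that] by simp
  qed (use sub in \<open>auto simp: space_measure_of_conv\<close>)
  then show "sets (lebesgue_product d) \<subseteq> ?S"
  proof (intro subsetI)
    fix A assume m: "(\<lambda>x. x) \<in> measurable ?N (lebesgue_product d)"
      and A: "A \<in> sets (lebesgue_product d)"
    have "A \<subseteq> topspace (space_top d)" using sets.sets_into_space[OF A] sp by simp
    then have "(\<lambda>x. x) -` A \<inter> space ?N = A" by (auto simp: space_measure_of_conv)
    with measurable_sets[OF m A] show "A \<in> ?S" using sub by (simp add: sets_measure_of)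
  qed
qed

definition nice_measure :: "nat \<Rightarrow> (nat \<Rightarrow> real) measure \<Rightarrow> bool" where
  "nice_measure d \<mu> \<longleftrightarrow>
     finite_measure \<mu> \<and> emeasure \<mu> (space \<mu>) \<noteq> 0 \<and>
     (\<exists>f. continuous_map (space_top d) euclideanreal f \<and>
          (\<forall>x \<in> topspace (space_top d). 0 < f x) \<and>
          \<mu> = density (lebesgue_product d) (\<lambda>x. ennreal (f x)))"

definition convex_in :: "nat \<Rightarrow> (nat \<Rightarrow> real) set \<Rightarrow> bool" where
  "convex_in d S \<longleftrightarrow>
     S \<subseteq> topspace (space_top d) \<and>
     (\<forall>x\<in>S. \<forall>y\<in>S. \<forall>u\<ge>0. \<forall>v\<ge>0. u + v = 1 \<longrightarrow> (\<lambda>i\<in>{..<d}. u * x i + v * y i) \<in> S)"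

definition convex_partition :: "nat \<Rightarrow> nat \<Rightarrow> (nat \<Rightarrow> real) set set \<Rightarrow> bool" where
  "convex_partition d n P \<longleftrightarrow>
     finite P \<and> card P = n \<and> \<Union>P = topspace (space_top d) \<and>
     (\<forall>A\<in>P. closedin (space_top d) A \<and> convex_in d A \<and> space_top d interior_of A \<noteq> {}) \<and>
     (\<forall>A\<in>P. \<forall>B\<in>P. A \<noteq> B \<longrightarrow>
        space_top d interior_of A \<inter> space_top d interior_of B = {})"

definition hyperplane :: "nat \<Rightarrow> (nat \<Rightarrow> real) set \<Rightarrow> bool" where
  "hyperplane d H \<longleftrightarrow>
     (\<exists>a b. (\<exists>i<d. a i \<noteq> 0) \<and>
            H = {x \<in> topspace (space_top d). (\<Sum>i<d. a i * x i) = (b::real)})"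

definition avoids :: "nat \<Rightarrow> (nat \<Rightarrow> real) set \<Rightarrow> (nat \<Rightarrow> real) set \<Rightarrow> bool" where
  "avoids d H A \<longleftrightarrow> H \<inter> space_top d interior_of A = {}"

definition avoidable_parts :: "nat \<Rightarrow> nat \<Rightarrow> nat \<Rightarrow> bool" where
  "avoidable_parts d k n \<longleftrightarrow>
     (\<forall>\<mu>. nice_measure d \<mu> \<longrightarrow>
        (\<exists>P. convex_partition d n P \<and>
             (\<forall>A\<in>P. \<forall>B\<in>P. emeasure \<mu> A = emeasure \<mu> B) \<and>
             (\<forall>H. hyperplane d H \<longrightarrow> k \<le> card {A \<in> P. avoids d H A})))"

text \<open>This is $N_d(k)$. The infimum in \<open>enat\<close> is the least such \<open>n\<close> if there is one, and \<open>\<infinity>\<close> otherwise.\<close>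

definition min_parts :: "nat \<Rightarrow> nat \<Rightarrow> enat" where
  "min_parts d k = Inf {enat n | n. 0 < n \<and> avoidable_parts d k n}"

end

theory Submission
  imports Defs "HOL-Probability.Distributions"
begin

text \<open>
  The measure that forces many parts is the standard Gaussian measure \<open>\<gamma>\<close>. Let \<open>P\<close> be a convex
  partition of \<open>\<real>\<^sup>d\<close> into \<open>n\<close> parts of equal Gaussian measure such that every hyperplane avoids a
  part. Only the hyperplanes through the origin are needed. If the hyperplane orthogonal to \<open>u\<close>
  avoids the convex part \<open>A\<close>, then \<open>A\<close> lies on one side of it (\<open>avoids_imp_polar_cone\<close>), that is,
  \<open>u\<close> or \<open>-u\<close> lies in the polar cone \<open>A\<^sup>o = {u. \<forall>x\<in>A. \<langle>u, x\<rangle> \<le> 0}\<close>. Hence the cones \<open>A\<^sup>o\<close> and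
  \<open>-A\<^sup>o\<close> cover the space, and \<open>1 \<le> 2 * (\<Sum>A\<in>P. \<gamma> A\<^sup>o)\<close> by the symmetry of \<open>\<gamma>\<close>.

  On the other hand \<open>\<gamma> A * \<gamma> A\<^sup>o \<le> 2\<^sup>-\<^sup>d\<close> (\<open>std_gaussian_mult_le\<close>). Indeed, if \<open>\<langle>x, y\<rangle> \<le> 0\<close> then
  \<open>\<bar>x\<bar>\<^sup>2 + \<bar>y\<bar>\<^sup>2 \<ge> \<bar>x + y\<bar>\<^sup>2\<close>, so the product of the Gaussian densities at \<open>x\<close> and \<open>y\<close> is at most the
  square of \<open>(2 * pi) powr (- d / 2) * exp (- \<bar>z\<bar>\<^sup>2)\<close> at the midpoint \<open>z = (x + y) / 2\<close>. That
  function has integral \<open>2 powr (- d / 2)\<close>, and the Prekopa-Leindler inequality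
  (\<open>prekopa_leindler_PiM\<close>) gives the bound.

  The parts have a common measure \<open>m\<close> with \<open>n * m \<ge> 1\<close>. Multiplying the covering inequality by \<open>m\<close>
  gives \<open>m \<le> 2 * n * 2\<^sup>-\<^sup>d\<close>, so \<open>1 \<le> n * m \<le> 2 * n\<^sup>2 * 2\<^sup>-\<^sup>d\<close>, and the theorem holds with
  \<open>C = 1 / sqrt 2\<close>.

  The midpoint case of the Prekopa-Leindler inequality is proved in dimension one by applying the
  one-dimensional Brunn-Minkowski inequality to superlevel sets, and in product spaces by induction
  on the number of coordinates.
\<close>

section \<open>The Brunn-Minkowski inequality on the line\<close>

text \<open>
  If \<open>a\<close> is the maximum of \<open>A\<close> and \<open>b\<close> the minimum of \<open>B\<close>, then the translates \<open>A + b\<close> and \<open>B + a\<close>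
  are contained in \<open>A + B\<close> and meet only in \<open>a + b\<close>. The set \<open>D\<close> contains the midpoints; it is
  separate from \<open>A\<close> and \<open>B\<close> so that no measurability of \<open>A + B\<close> is required.
\<close>

lemma brunn_minkowski_real_compact:
  fixes A B D :: "real set"
  assumes "compact A" "compact B" "A \<noteq> {}" "B \<noteq> {}" and D: "D \<in> sets borel"
    and AB: "\<And>a b. a \<in> A \<Longrightarrow> b \<in> B \<Longrightarrow> (a + b) / 2 \<in> D"
  shows "emeasure lborel A + emeasure lborel B \<le> 2 * emeasure lborel D"
proof -
  obtain a where a: "a \<in> A" "\<And>x. x \<in> A \<Longrightarrow> x \<le> a"
    using compact_attains_sup[OF assms(1,3)] by blast
  obtain b where b: "b \<in> B" "\<And>x. x \<in> B \<Longrightarrow> b \<le> x"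
    using compact_attains_inf[OF assms(2,4)] by blast
  have [measurable]: "A \<in> sets borel" "B \<in> sets borel" "D \<in> sets borel"
    using assms by (auto intro: borel_compact)
  have vol: "emeasure lborel S = \<bar>c\<bar> * emeasure lborel {x. t + c * x \<in> S}"
    if [measurable]: "S \<in> sets borel" and "c \<noteq> 0" for S and t c :: real
  proof -
    have "emeasure lborel S = (\<integral>\<^sup>+x. indicator S x \<partial>lborel)" by simp
    also have "\<dots> = \<bar>c\<bar> * (\<integral>\<^sup>+x. indicator S (t + c * x) \<partial>lborel)"
      using that by (intro nn_integral_real_affine) auto
    also have "(\<integral>\<^sup>+x. indicator S (t + c * x) \<partial>lborel)
        = (\<integral>\<^sup>+x. indicator {x. t + c * x \<in> S} x \<partial>lborel)"
      by (intro nn_integral_cong) (auto simp: indicator_def)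
    also have "\<dots> = emeasure lborel {x. t + c * x \<in> S}" by simp
    finally show ?thesis .
  qed
  have two: "(2::ennreal) * ennreal (1/2) = 1"
    by (simp only: ennreal_numeral[symmetric] ennreal_mult[symmetric]) simp
  let ?A = "{x. (- b) + 1 * x \<in> A}" and ?B = "{x. (- a) + 1 * x \<in> B}"
  let ?D = "{x. 0 + (1/2) * x \<in> D}"
  have "emeasure lborel A + emeasure lborel B = emeasure lborel ?A + emeasure lborel ?B"
    using vol[of A 1 "- b"] vol[of B 1 "- a"] by simp
  also have "\<dots> = emeasure lborel ?A + emeasure lborel (?B - {a + b})"
    by (subst emeasure_Diff_null_set) auto
  also have "\<dots> = emeasure lborel (?A \<union> (?B - {a + b}))"
  proof (rule plus_emeasure)
    have False if x: "x - b \<in> A" "x - a \<in> B" "x \<noteq> a + b" for x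
      using a(2)[OF x(1)] b(2)[OF x(2)] x(3) by simp
    then show "?A \<inter> (?B - {a + b}) = {}" by auto
  qed auto
  also have "\<dots> \<le> emeasure lborel ?D"
  proof (rule emeasure_mono)
    show "?A \<union> (?B - {a + b}) \<subseteq> ?D"
      using AB[OF _ b(1)] AB[OF a(1)] by fastforce
  qed auto
  also have "\<dots> = 2 * (ennreal (1/2) * emeasure lborel ?D)"
    by (simp only: mult.assoc[symmetric] two mult_1_left)
  also have "ennreal (1/2) * emeasure lborel ?D = emeasure lborel D"
    using vol[of D "1/2" 0] by simp
  finally show ?thesis .
qed

lemma brunn_minkowski_real:
  fixes A B D :: "real set"
  assumes A: "A \<in> sets borel" and B: "B \<in> sets borel" and D: "D \<in> sets borel"
    and ne: "A \<noteq> {}" "B \<noteq> {}"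
    and AB: "\<And>a b. a \<in> A \<Longrightarrow> b \<in> B \<Longrightarrow> (a + b) / 2 \<in> D"
  shows "emeasure lborel A + emeasure lborel B \<le> 2 * emeasure lborel D"
proof -
  have approx: "\<exists>K. compact K \<and> K \<noteq> {} \<and> K \<subseteq> S \<and> emeasure lborel S \<le> emeasure lborel K + ennreal e"
    if S: "S \<in> sets borel" "S \<noteq> {}" "bounded S" and e: "0 < e" for S :: "real set" and e :: real
  proof -
    obtain T where T: "closed T" "T \<subseteq> S" "S - T \<in> lmeasurable" "emeasure lebesgue (S - T) < ennreal e"
      using sets_lebesgue_inner_closed[of S e] S(1) e by auto
    obtain s where s: "s \<in> S" using S(2) by blast
    \<comment> \<open>The point \<open>s\<close> makes the compact approximation nonempty, even if \<open>T\<close> is empty.\<close>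
    have "compact (insert s T)"
      using T(1) bounded_subset[OF S(3) T(2)]
      by (intro compact_insert) (simp add: compact_eq_bounded_closed)
    moreover have "emeasure lborel S \<le> emeasure lborel (insert s T) + ennreal e"
    proof -
      have T': "T \<in> sets borel" using T(1) by (rule borel_closed)
      have "emeasure lborel S \<le> emeasure lborel (T \<union> (S - T))"
        using S(1) T' by (intro emeasure_mono) auto
      also have "\<dots> \<le> emeasure lborel T + emeasure lborel (S - T)"
        using S(1) T' by (intro emeasure_subadditive) auto
      also have "\<dots> \<le> emeasure lborel (insert s T) + ennreal e"
        using T(4) S(1) T' by (intro add_mono emeasure_mono) auto
      finally show ?thesis .
    qed
    ultimately show ?thesis using T(2) s by blast
  qed
  have bounded: "emeasure lborel S + emeasure lborel T \<le> 2 * emeasure lborel D"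
    if S: "S \<in> sets borel" "S \<noteq> {}" "bounded S" "S \<subseteq> A" and T: "T \<in> sets borel" "T \<noteq> {}" "bounded T" "T \<subseteq> B"
    for S T
  proof (rule ennreal_le_epsilon)
    fix e :: real assume "0 < e"
    then have e2: "0 < e / 2" by simp
    obtain K where K: "compact K" "K \<noteq> {}" "K \<subseteq> S" "emeasure lborel S \<le> emeasure lborel K + ennreal (e/2)"
      using approx[OF S(1-3) e2] by blast
    obtain L where L: "compact L" "L \<noteq> {}" "L \<subseteq> T" "emeasure lborel T \<le> emeasure lborel L + ennreal (e/2)"
      using approx[OF T(1-3) e2] by blast
    have "emeasure lborel S + emeasure lborel T
        \<le> (emeasure lborel K + ennreal (e/2)) + (emeasure lborel L + ennreal (e/2))"
      by (intro add_mono K L)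
    also have "\<dots> = (emeasure lborel K + emeasure lborel L) + (ennreal (e/2) + ennreal (e/2))"
      by (simp add: ac_simps)
    also have "ennreal (e/2) + ennreal (e/2) = ennreal e"
      using e2 by (subst ennreal_plus[symmetric]) auto
    also have "emeasure lborel K + emeasure lborel L \<le> 2 * emeasure lborel D"
      using K L S(4) T(4) by (intro brunn_minkowski_real_compact D AB) auto
    finally show "emeasure lborel S + emeasure lborel T \<le> 2 * emeasure lborel D + ennreal e"
      by (simp add: add_right_mono)
  qed
  define I where "I = (\<lambda>n::nat. {- real n..real n})"
  have lim: "(\<lambda>n. emeasure lborel (S \<inter> I n)) \<longlonglongrightarrow> emeasure lborel S" if "S \<in> sets borel" for S
  proof -
    have "incseq (\<lambda>n. S \<inter> I n)" by (force simp: incseq_def I_def)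
    moreover have "(\<Union>n. S \<inter> I n) = S"
    proof -
      have "\<exists>n. x \<in> I n" for x
        using real_arch_simple[of "\<bar>x\<bar>"] by (auto simp: I_def abs_le_iff minus_le_iff)
      then show ?thesis by blast
    qed
    moreover have "range (\<lambda>n. S \<inter> I n) \<subseteq> sets lborel"
      using that by (auto simp: I_def)
    ultimately show ?thesis
      using Lim_emeasure_incseq[of "\<lambda>n. S \<inter> I n" lborel] by simp
  qed
  obtain a b where ab: "a \<in> A" "b \<in> B" using ne by blast
  obtain N where N: "max \<bar>a\<bar> \<bar>b\<bar> \<le> real N" using real_arch_simple by blast
  show ?thesis
  proof (rule tendsto_upperbound)
    show "(\<lambda>n. emeasure lborel (A \<inter> I n) + emeasure lborel (B \<inter> I n))
        \<longlonglongrightarrow> emeasure lborel A + emeasure lborel B"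
      using lim[OF A] lim[OF B] by (rule tendsto_add)
    show "\<forall>\<^sub>F n in sequentially.
        emeasure lborel (A \<inter> I n) + emeasure lborel (B \<inter> I n) \<le> 2 * emeasure lborel D"
    proof (rule eventually_sequentiallyI)
      fix n assume n: "N \<le> n"
      have "\<bar>a\<bar> \<le> real n" "\<bar>b\<bar> \<le> real n" using N n by auto
      then have "a \<in> A \<inter> I n" "b \<in> B \<inter> I n"
        using ab by (auto simp: I_def abs_le_iff minus_le_iff)
      moreover have "bounded (I n)" by (simp add: I_def)
      ultimately show "emeasure lborel (A \<inter> I n) + emeasure lborel (B \<inter> I n) \<le> 2 * emeasure lborel D"
        using A B by (intro bounded bounded_Int) (auto simp: I_def)
    qed
  qed simp
qed

section \<open>The Prekopa-Leindler inequality for midpoints\<close>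

lemma nn_integral_layer_cake:
  fixes F :: "'a \<Rightarrow> ennreal"
  assumes "sigma_finite_measure M" and F[measurable]: "F \<in> borel_measurable M"
  shows "(\<integral>\<^sup>+x. F x \<partial>M)
    = (\<integral>\<^sup>+l. indicator {0<..} l * emeasure M {x \<in> space M. ennreal l < F x} \<partial>lborel)"
proof -
  interpret sigma_finite_measure M by fact
  interpret pair_sigma_finite M lborel by unfold_locales
  \<comment> \<open>A value \<open>c\<close> is the length of the interval of the positive levels below it.\<close>
  have len: "(\<integral>\<^sup>+l. indicator {0<..} l * indicator {l. ennreal l < c} l \<partial>lborel) = c" for c :: ennreal
  proof (cases c)
    case (real r)
    have "(\<integral>\<^sup>+l. indicator {0<..} l * indicator {l. ennreal l < c} l \<partial>lborel)
        = (\<integral>\<^sup>+l. indicator {0<..<r} l \<partial>lborel)"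
      using real by (intro nn_integral_cong) (auto simp: indicator_def ennreal_less_iff)
    then show ?thesis using real by simp
  next
    case top
    have "(\<integral>\<^sup>+l. indicator {0<..} l * indicator {l. ennreal l < c} l \<partial>lborel)
        = (\<integral>\<^sup>+l. indicator {0<..} (l::real) \<partial>lborel)"
      using top by (intro nn_integral_cong) (auto simp: indicator_def)
    also have "\<dots> = emeasure lborel {0::real<..}" by simp
    also have "\<dots> = top"
    proof (rule ccontr)
      assume "emeasure lborel {0::real<..} \<noteq> top"
      then obtain n where n: "emeasure lborel {0::real<..} < of_nat n"
        using ennreal_Ex_less_of_nat by (auto simp: less_top)
      have "of_nat n = emeasure lborel {0<..real n}" by (simp add: ennreal_of_nat_eq_real_of_nat)
      also have "\<dots> \<le> emeasure lborel {0::real<..}" by (intro emeasure_mono) auto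
      finally show False using n by simp
    qed
    finally show ?thesis using top by simp
  qed
  have "(\<integral>\<^sup>+x. F x \<partial>M)
      = (\<integral>\<^sup>+x. (\<integral>\<^sup>+l. indicator {0<..} l * indicator {l. ennreal l < F x} l \<partial>lborel) \<partial>M)"
    by (simp only: len)
  also have "\<dots> = (\<integral>\<^sup>+l. (\<integral>\<^sup>+x. indicator {0<..} l * indicator {l. ennreal l < F x} l \<partial>M) \<partial>lborel)"
    by (rule Fubini'[symmetric]) measurable
  also have "\<dots> = (\<integral>\<^sup>+l. indicator {0<..} l * emeasure M {x \<in> space M. ennreal l < F x} \<partial>lborel)"
  proof (intro nn_integral_cong)
    fix l :: real
    have "(\<integral>\<^sup>+x. indicator {0<..} l * indicator {l. ennreal l < F x} l \<partial>M)
        = (\<integral>\<^sup>+x. indicator {0<..} l * indicator {x \<in> space M. ennreal l < F x} x \<partial>M)"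
      by (intro nn_integral_cong) (auto simp: indicator_def)
    then show "(\<integral>\<^sup>+x. indicator {0<..} l * indicator {l. ennreal l < F x} l \<partial>M)
        = indicator {0<..} l * emeasure M {x \<in> space M. ennreal l < F x}"
      by (simp add: nn_integral_cmult)
  qed
  finally show ?thesis .
qed

text \<open>
  When \<open>F\<close> and \<open>G\<close> have the same supremum, their superlevel sets are nonempty for the same levels, so
  the Brunn-Minkowski inequality applies at every level at which one of them is nonempty. The result
  is the stronger bound by the arithmetic mean.
\<close>

lemma prekopa_leindler_real_equal_sup:
  fixes F G H :: "real \<Rightarrow> ennreal"
  assumes [measurable]: "F \<in> borel_measurable borel" "G \<in> borel_measurable borel" "H \<in> borel_measurable borel"
    and le: "\<And>s t. F s * G t \<le> (H ((s + t) / 2))\<^sup>2"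
    and sup: "(SUP s. F s) = (SUP t. G t)"
  shows "(\<integral>\<^sup>+s. F s \<partial>lborel) + (\<integral>\<^sup>+t. G t \<partial>lborel) \<le> 2 * (\<integral>\<^sup>+z. H z \<partial>lborel)"
proof -
  let ?lev = "\<lambda>(F :: real \<Rightarrow> ennreal) l. {x. ennreal l < F x}"
  let ?m = "\<lambda>F l. indicator {0<..} l * emeasure lborel (?lev F l) :: ennreal"
  have cake: "(\<integral>\<^sup>+s. F s \<partial>lborel) = (\<integral>\<^sup>+l. ?m F l \<partial>lborel)"
    if [measurable]: "F \<in> borel_measurable borel" for F
    using nn_integral_layer_cake[of lborel F] by (simp add: lborel.sigma_finite_measure_axioms)
  have meas: "(\<lambda>l. ?m F l) \<in> borel_measurable borel"
    if [measurable]: "F \<in> borel_measurable borel" for F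
  proof -
    have "{p \<in> space (lborel \<Otimes>\<^sub>M lborel). ennreal (fst p) < F (snd p)} \<in> sets (lborel \<Otimes>\<^sub>M lborel)"
      by measurable
    from lborel.measurable_emeasure_Pair[OF this]
    have [measurable]: "(\<lambda>l. emeasure lborel (?lev F l)) \<in> borel_measurable borel"
      by (simp add: vimage_def space_pair_measure)
    show ?thesis by measurable
  qed
  have lev: "?m F l + ?m G l \<le> 2 * ?m H l" for l
  proof (cases "0 < l \<and> ennreal l < (SUP s. F s)")
    case True
    then have l: "0 < l" by simp
    have "emeasure lborel (?lev F l) + emeasure lborel (?lev G l) \<le> 2 * emeasure lborel (?lev H l)"
    proof (rule brunn_minkowski_real)
      show "?lev F l \<noteq> {}" using True by (auto simp: less_SUP_iff)
      show "?lev G l \<noteq> {}" using True unfolding sup by (auto simp: less_SUP_iff)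
      fix s t assume "s \<in> ?lev F l" "t \<in> ?lev G l"
      then have st: "ennreal l < F s" "ennreal l < G t" by auto
      have "ennreal l * ennreal l < F s * ennreal l"
        using l st(1) by (intro ennreal_mult_strict_right_mono) auto
      also have "\<dots> \<le> F s * G t" using st(2) by (intro mult_left_mono) auto
      also note le
      finally have "(ennreal l)\<^sup>2 < (H ((s + t) / 2))\<^sup>2" by (simp add: power2_eq_square)
      then show "(s + t) / 2 \<in> ?lev H l"
        using power_mono[of "H ((s + t) / 2)" "ennreal l" 2] by (auto simp: not_le[symmetric])
    qed measurable
    then show ?thesis using l by simp
  next
    case False
    have "?lev F l = {} \<and> ?lev G l = {}" if "0 < l"
    proof -
      have "(SUP s. F s) \<le> ennreal l" using False that by simp
      moreover from this have "(SUP s. G s) \<le> ennreal l" by (simp only: sup)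
      ultimately show ?thesis by (auto simp: SUP_le_iff not_less)
    qed
    then show ?thesis by (auto simp: indicator_def)
  qed
  have "(\<integral>\<^sup>+s. F s \<partial>lborel) + (\<integral>\<^sup>+t. G t \<partial>lborel) = (\<integral>\<^sup>+l. ?m F l + ?m G l \<partial>lborel)"
    unfolding cake[OF assms(1)] cake[OF assms(2)] using meas
    by (intro nn_integral_add[symmetric]) simp_all
  also have "\<dots> \<le> (\<integral>\<^sup>+l. 2 * ?m H l \<partial>lborel)"
    by (intro nn_integral_mono lev)
  also have "\<dots> = 2 * (\<integral>\<^sup>+z. H z \<partial>lborel)"
    unfolding cake[OF assms(3)] using meas
    by (intro nn_integral_cmult) simp
  finally show ?thesis .
qed

lemma ennreal_four_mult_le_square_add:
  fixes x y :: ennreal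
  shows "4 * (x * y) \<le> (x + y)\<^sup>2"
proof (cases x; cases y)
  fix r s assume rs: "x = ennreal r" "0 \<le> r" "y = ennreal s" "0 \<le> s"
  have "4 * (r * s) \<le> (r + s)\<^sup>2"
    using zero_le_power2[of "r - s"] by (simp add: power2_eq_square algebra_simps)
  then show ?thesis
    using rs by (simp add: ennreal_mult[symmetric] ennreal_plus[symmetric] ennreal_power
        ennreal_numeral[symmetric] del: ennreal_numeral ennreal_plus)
qed (auto simp: power2_eq_square)

text \<open>
  Rescaling \<open>G\<close> by the quotient \<open>c\<close> of the suprema, and \<open>H\<close> by the square root of \<open>c\<close>, reduces the
  statement to equal suprema. The inequality of the arithmetic and geometric means then gives the
  bound for the product, in which \<open>c\<close> cancels.
\<close>

lemma prekopa_leindler_real_finite_sup: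
  fixes F G H :: "real \<Rightarrow> ennreal"
  assumes [measurable]: "F \<in> borel_measurable borel" "G \<in> borel_measurable borel" "H \<in> borel_measurable borel"
    and le: "\<And>s t. F s * G t \<le> (H ((s + t) / 2))\<^sup>2"
    and fin: "(SUP s. F s) \<noteq> top" "(SUP t. G t) \<noteq> top"
  shows "(\<integral>\<^sup>+s. F s \<partial>lborel) * (\<integral>\<^sup>+t. G t \<partial>lborel) \<le> (\<integral>\<^sup>+z. H z \<partial>lborel)\<^sup>2"
proof (cases "(SUP s. F s) = 0 \<or> (SUP t. G t) = 0")
  case True
  then have "(\<forall>s. F s = 0) \<or> (\<forall>t. G t = 0)" by (auto simp: SUP_eq_iff bot_ennreal)
  then show ?thesis by auto
next
  case False
  obtain a where a: "(SUP s. F s) = ennreal a" "0 < a"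
    using fin(1) False by (cases "SUP s. F s") (auto simp: less_le)
  obtain b where b: "(SUP t. G t) = ennreal b" "0 < b"
    using fin(2) False by (cases "SUP t. G t") (auto simp: less_le)
  define q where "q = sqrt (a / b)"
  define c where "c = ennreal (q\<^sup>2)"
  have q: "0 < q" "q\<^sup>2 = a / b" using a b by (auto simp: q_def)
  have c: "c = ennreal q ^ 2" using q by (simp add: c_def ennreal_power)
  have c0: "c \<noteq> 0" "c \<noteq> top" using q(1) by (auto simp: c_def)
  let ?F = "\<integral>\<^sup>+s. F s \<partial>lborel" and ?G = "\<integral>\<^sup>+t. G t \<partial>lborel" and ?H = "\<integral>\<^sup>+z. H z \<partial>lborel"
  have "?F + (\<integral>\<^sup>+t. c * G t \<partial>lborel) \<le> 2 * (\<integral>\<^sup>+z. ennreal q * H z \<partial>lborel)"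
  proof (rule prekopa_leindler_real_equal_sup)
    show "F s * (c * G t) \<le> (ennreal q * H ((s + t) / 2))\<^sup>2" for s t
      using mult_left_mono[OF le[of s t], of c] by (simp add: c power_mult_distrib ac_simps)
    have "(SUP t. c * G t) = c * (SUP t. G t)" by (rule SUP_mult_left_ennreal[symmetric])
    also have "\<dots> = ennreal a"
      using a b q by (simp add: c_def ennreal_mult[symmetric])
    finally show "(SUP s. F s) = (SUP t. c * G t)" by (simp add: a)
  qed measurable
  then have sum: "?F + c * ?G \<le> 2 * (ennreal q * ?H)" by (simp add: nn_integral_cmult)
  have "(4 * c) * (?F * ?G) = 4 * (?F * (c * ?G))" by (simp add: ac_simps)
  also have "\<dots> \<le> (?F + c * ?G)\<^sup>2" by (rule ennreal_four_mult_le_square_add)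
  also have "\<dots> \<le> (2 * (ennreal q * ?H))\<^sup>2" by (intro power_mono sum) simp
  also have "\<dots> = (4 * c) * ?H\<^sup>2" by (simp add: c power_mult_distrib ac_simps)
  finally show ?thesis
    using c0 by (subst (asm) ennreal_mult_le_mult_iff) (auto simp: ennreal_mult_eq_top_iff)
qed

text \<open>
  Truncating \<open>F\<close> and \<open>G\<close> at integer heights makes the suprema finite and preserves the hypothesis.
\<close>

lemma prekopa_leindler_real:
  fixes F G H :: "real \<Rightarrow> ennreal"
  assumes [measurable]: "F \<in> borel_measurable borel" "G \<in> borel_measurable borel" "H \<in> borel_measurable borel"
    and le: "\<And>s t. F s * G t \<le> (H ((s + t) / 2))\<^sup>2"
  shows "(\<integral>\<^sup>+s. F s \<partial>lborel) * (\<integral>\<^sup>+t. G t \<partial>lborel) \<le> (\<integral>\<^sup>+z. H z \<partial>lborel)\<^sup>2"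
proof -
  have trunc: "(\<integral>\<^sup>+s. F s \<partial>lborel) = (SUP k. \<integral>\<^sup>+s. min (F s) (of_nat k) \<partial>lborel)"
    if [measurable]: "F \<in> borel_measurable borel" for F :: "real \<Rightarrow> ennreal"
  proof -
    have "(SUP k. min (F s) (of_nat k)) = F s" for s
    proof -
      have "(SUP k. min (F s) (of_nat k)) = inf (F s) (SUP k. of_nat k)"
        by (simp add: inf_min[symmetric] inf_SUP)
      then show ?thesis by (simp add: ennreal_SUP_of_nat_eq_top)
    qed
    then have "(\<integral>\<^sup>+s. F s \<partial>lborel) = (\<integral>\<^sup>+s. (SUP k. min (F s) (of_nat k)) \<partial>lborel)" by simp
    also have "\<dots> = (SUP k. \<integral>\<^sup>+s. min (F s) (of_nat k) \<partial>lborel)"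
      by (rule nn_integral_monotone_convergence_SUP)
         (auto simp: incseq_def le_fun_def intro: min.coboundedI2)
    finally show ?thesis .
  qed
  have bd: "(SUP s. min (F s) (of_nat k)) \<noteq> top" for F :: "real \<Rightarrow> ennreal" and k
  proof -
    have "(SUP s. min (F s) (of_nat k)) \<le> of_nat k" by (intro SUP_least) simp
    then show ?thesis by (metis ennreal_of_nat_neq_top top_unique)
  qed
  have "(\<integral>\<^sup>+s. min (F s) (of_nat j) \<partial>lborel) * (\<integral>\<^sup>+t. min (G t) (of_nat k) \<partial>lborel)
      \<le> (\<integral>\<^sup>+z. H z \<partial>lborel)\<^sup>2" for j k
  proof (rule prekopa_leindler_real_finite_sup)
    fix s t
    have "min (F s) (of_nat j) * min (G t) (of_nat k) \<le> F s * G t" by (intro mult_mono) auto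
    also note le
    finally show "min (F s) (of_nat j) * min (G t) (of_nat k) \<le> (H ((s + t) / 2))\<^sup>2" .
  qed (use bd in measurable)
  then show ?thesis
    unfolding trunc[OF assms(1)] trunc[OF assms(2)]
    by (simp add: SUP_mult_left_ennreal SUP_mult_right_ennreal SUP_le_iff)
qed

text \<open>
  Fixing one coordinate of each of the three functions leaves functions that satisfy the hypothesis
  in the remaining coordinates. By induction their integrals, as functions of the fixed coordinate,
  satisfy the hypothesis in dimension one.
\<close>

lemma prekopa_leindler_PiM:
  fixes f g h :: "('i \<Rightarrow> real) \<Rightarrow> ennreal"
  assumes "finite I"
    and "f \<in> borel_measurable (Pi\<^sub>M I (\<lambda>_. lborel))"
        "g \<in> borel_measurable (Pi\<^sub>M I (\<lambda>_. lborel))"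
        "h \<in> borel_measurable (Pi\<^sub>M I (\<lambda>_. lborel))"
    and "\<And>x y. x \<in> Pi\<^sub>E I (\<lambda>_. UNIV) \<Longrightarrow> y \<in> Pi\<^sub>E I (\<lambda>_. UNIV) \<Longrightarrow>
           f x * g y \<le> (h (\<lambda>i\<in>I. (x i + y i) / 2))\<^sup>2"
  shows "(\<integral>\<^sup>+x. f x \<partial>Pi\<^sub>M I (\<lambda>_. lborel)) * (\<integral>\<^sup>+y. g y \<partial>Pi\<^sub>M I (\<lambda>_. lborel))
      \<le> (\<integral>\<^sup>+z. h z \<partial>Pi\<^sub>M I (\<lambda>_. lborel))\<^sup>2"
  using assms
proof (induction I arbitrary: f g h rule: finite_induct)
  case empty
  interpret product_sigma_finite "\<lambda>_::'i. lborel :: real measure" by standard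
  have "(\<lambda>i\<in>{}. (x i + y i) / 2) = (\<lambda>_. undefined)" for x y :: "'i \<Rightarrow> real" by auto
  then show ?case using empty(4)[of "\<lambda>_. undefined" "\<lambda>_. undefined"] by (simp add: nn_integral_empty)
next
  case (insert i I)
  interpret product_sigma_finite "\<lambda>_::'i. lborel :: real measure" by standard
  interpret I: finite_product_sigma_finite "\<lambda>_::'i. lborel :: real measure" I
    by standard (rule insert.hyps)
  note [measurable] = insert.prems(1-3)
  have sect: "(\<lambda>x. u (x(i := s))) \<in> borel_measurable (Pi\<^sub>M I (\<lambda>_. lborel))"
    if [measurable]: "u \<in> borel_measurable (Pi\<^sub>M (insert i I) (\<lambda>_. lborel))"
    for u :: "('i \<Rightarrow> real) \<Rightarrow> ennreal" and s :: real
    by measurable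
  have marg: "(\<lambda>s. \<integral>\<^sup>+x. u (x(i := s)) \<partial>Pi\<^sub>M I (\<lambda>_. lborel)) \<in> borel_measurable borel"
    if [measurable]: "u \<in> borel_measurable (Pi\<^sub>M (insert i I) (\<lambda>_. lborel))"
    for u :: "('i \<Rightarrow> real) \<Rightarrow> ennreal"
    by measurable
  have "(\<integral>\<^sup>+s. \<integral>\<^sup>+x. f (x(i := s)) \<partial>Pi\<^sub>M I (\<lambda>_. lborel) \<partial>lborel) *
      (\<integral>\<^sup>+t. \<integral>\<^sup>+y. g (y(i := t)) \<partial>Pi\<^sub>M I (\<lambda>_. lborel) \<partial>lborel)
      \<le> (\<integral>\<^sup>+r. \<integral>\<^sup>+z. h (z(i := r)) \<partial>Pi\<^sub>M I (\<lambda>_. lborel) \<partial>lborel)\<^sup>2"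
  proof (rule prekopa_leindler_real)
    fix s t :: real
    show "(\<integral>\<^sup>+x. f (x(i := s)) \<partial>Pi\<^sub>M I (\<lambda>_. lborel)) * (\<integral>\<^sup>+y. g (y(i := t)) \<partial>Pi\<^sub>M I (\<lambda>_. lborel))
        \<le> (\<integral>\<^sup>+z. h (z(i := (s + t) / 2)) \<partial>Pi\<^sub>M I (\<lambda>_. lborel))\<^sup>2"
    proof (rule insert.IH)
      fix x y :: "'i \<Rightarrow> real"
      assume xy: "x \<in> Pi\<^sub>E I (\<lambda>_. UNIV)" "y \<in> Pi\<^sub>E I (\<lambda>_. UNIV)"
      have mid: "(\<lambda>j\<in>insert i I. ((x(i := s)) j + (y(i := t)) j) / 2)
          = (\<lambda>j\<in>I. (x j + y j) / 2)(i := (s + t) / 2)"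
        using insert.hyps by auto
      have ins: "x(i := s) \<in> Pi\<^sub>E (insert i I) (\<lambda>_. UNIV)" "y(i := t) \<in> Pi\<^sub>E (insert i I) (\<lambda>_. UNIV)"
        using xy by (auto simp: PiE_def extensional_def)
      show "f (x(i := s)) * g (y(i := t)) \<le> (h ((\<lambda>j\<in>I. (x j + y j) / 2)(i := (s + t) / 2)))\<^sup>2"
        using insert.prems(4)[OF ins] unfolding mid .
    qed (intro sect insert.prems)+
  qed (intro marg insert.prems)+
  then show ?case
    using insert.hyps insert.prems by (simp add: product_nn_integral_insert_rev)
qed

lemma nn_integral_PiM_lborel_uminus:
  fixes f :: "('i \<Rightarrow> real) \<Rightarrow> ennreal"
  assumes "finite I" "f \<in> borel_measurable (Pi\<^sub>M I (\<lambda>_. lborel))"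
  shows "(\<integral>\<^sup>+x. f (\<lambda>i\<in>I. - x i) \<partial>Pi\<^sub>M I (\<lambda>_. lborel)) = (\<integral>\<^sup>+x. f x \<partial>Pi\<^sub>M I (\<lambda>_. lborel))"
  using assms
proof (induction I arbitrary: f rule: finite_induct)
  case empty
  interpret product_sigma_finite "\<lambda>_::'i. lborel :: real measure" by standard
  have "(\<lambda>i\<in>{}. - x i) = (\<lambda>_. undefined)" for x :: "'i \<Rightarrow> real" by auto
  then show ?case by (simp add: PiM_empty nn_integral_count_space_finite)
next
  case (insert i I)
  interpret product_sigma_finite "\<lambda>_::'i. lborel :: real measure" by standard
  interpret I: finite_product_sigma_finite "\<lambda>_::'i. lborel :: real measure" I
    by standard (rule insert.hyps)
  note [measurable] = insert.prems(1)
  have marg: "(\<lambda>s. \<integral>\<^sup>+x. f (x(i := s)) \<partial>Pi\<^sub>M I (\<lambda>_. lborel)) \<in> borel_measurable borel"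
    by measurable
  have neg: "(\<lambda>j\<in>insert i I. - (x(i := s)) j) = (\<lambda>j\<in>I. - x j)(i := - s)" for x :: "'i \<Rightarrow> real" and s
    using insert.hyps by auto
  have "(\<integral>\<^sup>+x. f (\<lambda>j\<in>insert i I. - x j) \<partial>Pi\<^sub>M (insert i I) (\<lambda>_. lborel))
      = (\<integral>\<^sup>+s. \<integral>\<^sup>+x. f ((\<lambda>j\<in>I. - x j)(i := - s)) \<partial>Pi\<^sub>M I (\<lambda>_. lborel) \<partial>lborel)"
    unfolding neg[symmetric] using insert.hyps
    by (intro product_nn_integral_insert_rev) measurable
  also have "\<dots> = (\<integral>\<^sup>+s. \<integral>\<^sup>+x. f (x(i := - s)) \<partial>Pi\<^sub>M I (\<lambda>_. lborel) \<partial>lborel)"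
    by (intro nn_integral_cong insert.IH) measurable
  also have "\<dots> = (\<integral>\<^sup>+s. \<integral>\<^sup>+x. f (x(i := s)) \<partial>Pi\<^sub>M I (\<lambda>_. lborel) \<partial>lborel)"
    by (subst nn_integral_real_affine[where c = "- 1" and t = 0 and
          f = "\<lambda>s. \<integral>\<^sup>+x. f (x(i := s)) \<partial>Pi\<^sub>M I (\<lambda>_. lborel)"])
      (use marg in simp_all)
  also have "\<dots> = (\<integral>\<^sup>+x. f x \<partial>Pi\<^sub>M (insert i I) (\<lambda>_. lborel))"
    using insert.hyps by (simp add: product_nn_integral_insert_rev)
  finally show ?case .
qed

section \<open>The standard Gaussian measure\<close>

text \<open>
  The standard Gaussian measure on \<open>\<real>\<^sup>d\<close>, given by its density with respect to Lebesgue measure.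
\<close>

definition std_gaussian :: "nat \<Rightarrow> (nat \<Rightarrow> real) measure" where
  "std_gaussian d = density (lebesgue_product d) (\<lambda>x. ennreal (\<Prod>i<d. std_normal_density (x i)))"

lemma space_lebesgue_product: "space (lebesgue_product d) = topspace (space_top d)"
  by (simp add: space_PiM)

lemma space_std_gaussian: "space (std_gaussian d) = topspace (space_top d)"
  by (simp only: std_gaussian_def space_density space_lebesgue_product)

lemma sets_std_gaussian [measurable_cong]: "sets (std_gaussian d) = sets (lebesgue_product d)"
  by (simp add: std_gaussian_def)

lemma borel_measurable_prod_components:
  fixes f :: "real \<Rightarrow> real"
  assumes [measurable]: "f \<in> borel_measurable borel"
  shows "(\<lambda>x. ennreal (\<Prod>i<d. f (x i))) \<in> borel_measurable (lebesgue_product d)"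
proof -
  have "(\<lambda>x. f (x i)) \<in> borel_measurable (lebesgue_product d)" if "i \<in> {..<d}" for i
    using that by measurable
  then show ?thesis by measurable
qed

lemma nn_integral_normal_density:
  assumes "0 < \<sigma>"
  shows "(\<integral>\<^sup>+x. ennreal (normal_density \<mu> \<sigma> x) \<partial>lborel) = 1"
  using assms by (simp add: nn_integral_eq_integral)

lemma nn_integral_prod_components:
  assumes [measurable]: "f \<in> borel_measurable borel" and "\<And>x. 0 \<le> f x"
  shows "(\<integral>\<^sup>+x. ennreal (\<Prod>i<d. f (x i)) \<partial>lebesgue_product d) = (\<integral>\<^sup>+x. ennreal (f x) \<partial>lborel) ^ d"
proof -
  interpret product_sigma_finite "\<lambda>_::nat. lborel :: real measure" by standard
  show ?thesis
    using assms(2) product_nn_integral_prod[of "{..<d}" "\<lambda>_ x. ennreal (f x)"]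
    by (simp add: prod_ennreal)
qed

lemma emeasure_std_gaussian:
  assumes "A \<in> sets (lebesgue_product d)"
  shows "emeasure (std_gaussian d) A
    = (\<integral>\<^sup>+x. ennreal (\<Prod>i<d. std_normal_density (x i)) * indicator A x \<partial>lebesgue_product d)"
  unfolding std_gaussian_def using assms
  by (intro emeasure_density borel_measurable_prod_components) auto

lemma emeasure_space_std_gaussian: "emeasure (std_gaussian d) (topspace (space_top d)) = 1"
proof -
  have "emeasure (std_gaussian d) (space (lebesgue_product d))
      = (\<integral>\<^sup>+x. ennreal (\<Prod>i<d. std_normal_density (x i)) * indicator (space (lebesgue_product d)) x
          \<partial>lebesgue_product d)"
    by (rule emeasure_std_gaussian) (rule sets.top)
  also have "\<dots> = (\<integral>\<^sup>+x. ennreal (\<Prod>i<d. std_normal_density (x i)) \<partial>lebesgue_product d)"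
    by (intro nn_integral_cong) (auto simp: indicator_def)
  also have "\<dots> = 1"
    by (simp add: nn_integral_prod_components nn_integral_normal_density)
  finally show ?thesis by (simp only: space_lebesgue_product)
qed

lemma nice_measure_std_gaussian: "nice_measure d (std_gaussian d)"
  unfolding nice_measure_def
proof (intro conjI exI[of _ "\<lambda>x. \<Prod>i<d. std_normal_density (x i)"] ballI)
  show "finite_measure (std_gaussian d)"
    by (rule finite_measureI) (simp add: space_std_gaussian emeasure_space_std_gaussian del: topspace_product_topology)
  show "emeasure (std_gaussian d) (space (std_gaussian d)) \<noteq> 0"
    by (simp add: space_std_gaussian emeasure_space_std_gaussian del: topspace_product_topology)
  show "continuous_map (space_top d) euclideanreal (\<lambda>x. \<Prod>i<d. std_normal_density (x i))"
  proof (rule continuous_map_prod)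
    fix i assume i: "i \<in> {..<d}"
    have "continuous_map euclideanreal euclideanreal std_normal_density"
      unfolding normal_density_def by (simp, intro continuous_intros) auto
    from continuous_map_compose[OF continuous_map_product_projection[OF i] this]
    show "continuous_map (space_top d) euclideanreal (\<lambda>x. std_normal_density (x i))"
      by (simp add: o_def)
  qed simp
  show "0 < (\<Prod>i<d. std_normal_density (x i))" for x :: "nat \<Rightarrow> real"
    by (intro prod_pos normal_density_pos) simp
  show "std_gaussian d = density (lebesgue_product d) (\<lambda>x. ennreal (\<Prod>i<d. std_normal_density (x i)))"
    by (rule std_gaussian_def)
qed

lemma prod_const_mult_exp:
  fixes c :: real
  shows "(\<Prod>i<d. c * exp (e i)) = c ^ d * exp (\<Sum>i<d. e i)"
  by (simp add: prod.distrib exp_sum)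

lemma prod_std_normal_density:
  "(\<Prod>i<d. std_normal_density (x i)) = (1 / sqrt (2 * pi)) ^ d * exp (- (\<Sum>i<d. (x i)\<^sup>2) / 2)"
  unfolding std_normal_density_def prod_const_mult_exp
  by (simp only: sum_negf[symmetric] sum_divide_distrib)

text \<open>
  The Gaussian inequality for two sets that make no acute angle with each other as seen from the
  origin. It is applied to a part of the partition and its polar cone.
\<close>

lemma std_gaussian_mult_le:
  assumes A: "A \<in> sets (lebesgue_product d)" and B: "B \<in> sets (lebesgue_product d)"
    and polar: "\<And>x y. x \<in> A \<Longrightarrow> y \<in> B \<Longrightarrow> (\<Sum>i<d. x i * y i) \<le> 0"
  shows "emeasure (std_gaussian d) A * emeasure (std_gaussian d) B \<le> ennreal ((1 / 2) ^ d)"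
proof -
  define w where "w = (\<lambda>z::real. 1 / sqrt (2 * pi) * exp (- z\<^sup>2))"
  let ?n = "\<lambda>x. ennreal (\<Prod>i<d. std_normal_density (x i))"
  \<comment> \<open>Up to the factor \<open>1 / sqrt 2\<close>, \<open>w\<close> is the normal density of variance \<open>1 / 2\<close>.\<close>
  have w: "w z = 1 / sqrt 2 * normal_density 0 (1 / sqrt 2) z" for z
    by (simp add: w_def normal_density_def power_divide real_sqrt_mult)
  have w_meas [measurable]: "w \<in> borel_measurable borel" unfolding w_def by measurable
  have int_w: "(\<integral>\<^sup>+z. ennreal (w z) \<partial>lborel) = ennreal (1 / sqrt 2)"
    unfolding w by (subst ennreal_mult) (simp_all add: nn_integral_cmult nn_integral_normal_density)
  have prod_w: "(\<Prod>i<d. w (z i)) = (1 / sqrt (2 * pi)) ^ d * exp (- (\<Sum>i<d. (z i)\<^sup>2))" for z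
    unfolding w_def prod_const_mult_exp by (simp only: sum_negf)
  have "emeasure (std_gaussian d) A * emeasure (std_gaussian d) B
      = (\<integral>\<^sup>+x. ?n x * indicator A x \<partial>lebesgue_product d) * (\<integral>\<^sup>+y. ?n y * indicator B y \<partial>lebesgue_product d)"
    by (simp only: emeasure_std_gaussian[OF A] emeasure_std_gaussian[OF B])
  also have "\<dots> \<le> (\<integral>\<^sup>+z. ennreal (\<Prod>i<d. w (z i)) \<partial>lebesgue_product d)\<^sup>2"
  proof (rule prekopa_leindler_PiM)
    fix x y
    show "?n x * indicator A x * (?n y * indicator B y)
        \<le> (ennreal (\<Prod>i<d. w ((\<lambda>i\<in>{..<d}. (x i + y i) / 2) i)))\<^sup>2"
    proof (cases "x \<in> A \<and> y \<in> B")
      case True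
      have "- (\<Sum>i<d. (x i)\<^sup>2) / 2 + - (\<Sum>i<d. (y i)\<^sup>2) / 2
          \<le> - 2 * (\<Sum>i<d. ((x i + y i) / 2)\<^sup>2)"
      proof -
        have "2 * (\<Sum>i<d. ((x i + y i) / 2)\<^sup>2)
            = (\<Sum>i<d. (x i)\<^sup>2) / 2 + (\<Sum>i<d. (y i)\<^sup>2) / 2 + (\<Sum>i<d. x i * y i)"
          by (simp add: sum_distrib_left sum_divide_distrib sum.distrib[symmetric])
             (intro sum.cong, auto simp: power2_eq_square field_simps)
        then show ?thesis using polar[of x y] True by simp
      qed
      then have "exp (- (\<Sum>i<d. (x i)\<^sup>2) / 2) * exp (- (\<Sum>i<d. (y i)\<^sup>2) / 2)
          \<le> (exp (- (\<Sum>i<d. ((x i + y i) / 2)\<^sup>2)))\<^sup>2"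
        by (simp add: exp_add[symmetric] exp_double[symmetric])
      then have "(\<Prod>i<d. std_normal_density (x i)) * (\<Prod>i<d. std_normal_density (y i))
          \<le> (\<Prod>i<d. w ((x i + y i) / 2))\<^sup>2"
        unfolding prod_std_normal_density prod_w power_mult_distrib
        by (simp add: power2_eq_square mult.assoc mult.left_commute mult_left_mono)
      moreover have "(\<Prod>i<d. w ((\<lambda>i\<in>{..<d}. (x i + y i) / 2) i)) = (\<Prod>i<d. w ((x i + y i) / 2))"
        by (intro prod.cong) auto
      moreover have "0 \<le> (\<Prod>i<d. w ((x i + y i) / 2))"
        by (intro prod_nonneg) (simp add: w_def)
      ultimately show ?thesis
        using True by (simp add: ennreal_mult[symmetric] ennreal_power prod_nonneg ennreal_leI)
    qed auto
  qed (intro borel_measurable_times_ennreal borel_measurable_indicator borel_measurable_prod_components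
      borel_measurable_normal_density w_meas A B finite_lessThan)+
  also have "\<dots> = (ennreal (1 / sqrt 2) ^ d)\<^sup>2"
    by (subst nn_integral_prod_components) (simp_all add: int_w, simp add: w_def)
  also have "\<dots> = ennreal ((1 / 2) ^ d)"
  proof -
    have "((1 / sqrt 2) ^ d)\<^sup>2 = ((1 / sqrt 2)\<^sup>2) ^ d" by (simp only: power_mult[symmetric] mult.commute)
    also have "\<dots> = (1 / 2) ^ d" by (simp add: power_divide)
    finally show ?thesis by (simp only: ennreal_power[OF zero_le_power] ennreal_power
          real_sqrt_ge_zero zero_le_divide_1_iff zero_le_numeral zero_le_power)
  qed
  finally show ?thesis .
qed

lemma emeasure_std_gaussian_uminus:
  assumes B: "B \<in> sets (lebesgue_product d)"
  shows "{x \<in> topspace (space_top d). (\<lambda>i\<in>{..<d}. - x i) \<in> B} \<in> sets (lebesgue_product d)" (is "?B \<in> _")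
    and "emeasure (std_gaussian d) {x \<in> topspace (space_top d). (\<lambda>i\<in>{..<d}. - x i) \<in> B}
      = emeasure (std_gaussian d) B"
proof -
  have m: "(\<lambda>x. \<lambda>i\<in>{..<d}. - x i) \<in> measurable (lebesgue_product d) (lebesgue_product d)"
    by (rule measurable_restrict) measurable
  have "(\<lambda>x. \<lambda>i\<in>{..<d}. - x i) -` B \<inter> space (lebesgue_product d) = ?B"
    unfolding space_lebesgue_product by auto
  with measurable_sets[OF m B] show *: "?B \<in> sets (lebesgue_product d)" by simp
  let ?f = "\<lambda>x. ennreal (\<Prod>i<d. std_normal_density (x i)) * indicator B x"
  note [measurable] = borel_measurable_prod_components B
  have "emeasure (std_gaussian d) ?B = (\<integral>\<^sup>+x. ?f (\<lambda>i\<in>{..<d}. - x i) \<partial>lebesgue_product d)"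
    unfolding emeasure_std_gaussian[OF *]
  proof (intro nn_integral_cong)
    fix x assume "x \<in> space (lebesgue_product d)"
    then have "x \<in> topspace (space_top d)" by (simp only: space_lebesgue_product)
    moreover have "(\<Prod>i<d. std_normal_density (restrict (\<lambda>i. - x i) {..<d} i)) = (\<Prod>i<d. std_normal_density (x i))"
      by (intro prod.cong) (auto simp: normal_density_def)
    ultimately show "ennreal (\<Prod>i<d. std_normal_density (x i)) * indicator ?B x = ?f (\<lambda>i\<in>{..<d}. - x i)"
      by (simp add: indicator_def)
  qed
  also have "\<dots> = (\<integral>\<^sup>+x. ?f x \<partial>lebesgue_product d)"
    by (rule nn_integral_PiM_lborel_uminus) auto
  also have "\<dots> = emeasure (std_gaussian d) B"
    by (rule emeasure_std_gaussian[OF B, symmetric])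
  finally show "emeasure (std_gaussian d) ?B = emeasure (std_gaussian d) B" .
qed

section \<open>Polar cones of convex sets\<close>

text \<open>
  The polar cone of \<open>A\<close>, that is, the directions whose inner product with every point of \<open>A\<close> is at
  most 0. The set \<open>A\<close> need not be a cone.
\<close>

definition polar_cone :: "nat \<Rightarrow> (nat \<Rightarrow> real) set \<Rightarrow> (nat \<Rightarrow> real) set" where
  "polar_cone d A = {u \<in> topspace (space_top d). \<forall>x\<in>A. (\<Sum>i<d. u i * x i) \<le> 0}"

lemma closedin_space_top_measurable:
  assumes "closedin (space_top d) A"
  shows "A \<in> sets (lebesgue_product d)"
proof -
  have "topspace (space_top d) - A \<in> sets (lebesgue_product d)"
    using assms by (intro openin_space_top_measurable) (simp add: closedin_def)
  then have "space (lebesgue_product d) - (topspace (space_top d) - A) \<in> sets (lebesgue_product d)"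
    by (rule sets.compl_sets)
  moreover have "space (lebesgue_product d) - (topspace (space_top d) - A) = A"
    using closedin_subset[OF assms] unfolding space_lebesgue_product by blast
  ultimately show ?thesis by simp
qed

lemma polar_cone_measurable: "polar_cone d A \<in> sets (lebesgue_product d)"
proof (rule closedin_space_top_measurable)
  have "closedin (space_top d) {u \<in> topspace (space_top d). (\<Sum>i<d. u i * x i) \<in> {..0}}" for x
    by (intro closedin_continuous_map_preimage[where Y = euclideanreal] continuous_map_sum
        continuous_map_real_mult_right continuous_map_product_projection)
       (auto simp: closed_closedin[symmetric])
  then have "closedin (space_top d)
      (topspace (space_top d) \<inter> (\<Inter>x\<in>A. {u \<in> topspace (space_top d). (\<Sum>i<d. u i * x i) \<in> {..0}}))"
    by (cases "A = {}") (auto simp del: topspace_product_topology intro!: closedin_Int closedin_INT closedin_topspace)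
  moreover have "polar_cone d A
      = topspace (space_top d) \<inter> (\<Inter>x\<in>A. {u \<in> topspace (space_top d). (\<Sum>i<d. u i * x i) \<in> {..0}})"
    unfolding polar_cone_def by blast
  ultimately show "closedin (space_top d) (polar_cone d A)" by simp
qed

lemma std_gaussian_polar_cone_le:
  assumes "A \<in> sets (lebesgue_product d)"
  shows "emeasure (std_gaussian d) A * emeasure (std_gaussian d) (polar_cone d A) \<le> ennreal ((1 / 2) ^ d)"
proof (rule std_gaussian_mult_le[OF assms polar_cone_measurable])
  show "(\<Sum>i<d. x i * y i) \<le> 0" if "x \<in> A" "y \<in> polar_cone d A" for x y
    using that by (auto simp: polar_cone_def mult.commute)
qed

text \<open>
  The homothety with center \<open>x\<close> and ratio \<open>t\<close> maps the interior of \<open>A\<close> onto an open subset of \<open>A\<close>.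
\<close>

lemma convex_in_segment_interior:
  assumes A: "convex_in d A" and x: "x \<in> A" and p: "p \<in> space_top d interior_of A"
    and t: "0 < t" "t \<le> (1::real)"
  shows "(\<lambda>i\<in>{..<d}. (1 - t) * x i + t * p i) \<in> space_top d interior_of A"
proof -
  let ?U = "space_top d interior_of A"
  let ?g = "\<lambda>w. \<lambda>i\<in>{..<d}. (w i - (1 - t) * x i) / t"
  let ?V = "{w \<in> topspace (space_top d). ?g w \<in> ?U}"
  have comb: "(\<lambda>i\<in>{..<d}. (1 - t) * x i + t * y i) \<in> A" if "y \<in> A" for y
    using A x t that unfolding convex_in_def by simp
  have "continuous_map (space_top d) (space_top d) ?g"
  proof -
    have "continuous_map (space_top d) euclideanreal (\<lambda>w. ?g w i)" if i: "i \<in> {..<d}" for i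
    proof -
      have "continuous_map (space_top d) euclideanreal (\<lambda>w. (w i - (1 - t) * x i) / t)"
        using t i by (intro continuous_map_real_divide continuous_map_diff
            continuous_map_product_projection) auto
      then show ?thesis using i by simp
    qed
    then show ?thesis by (auto simp: continuous_map_componentwise)
  qed
  then have "openin (space_top d) ?V"
    by (rule openin_continuous_map_preimage) (rule openin_interior_of)
  moreover have "?V \<subseteq> A"
  proof
    fix w assume "w \<in> ?V"
    then have w: "w \<in> topspace (space_top d)" and gw: "?g w \<in> ?U" by (simp_all only: mem_Collect_eq)
    have "(\<lambda>i\<in>{..<d}. (1 - t) * x i + t * ?g w i) \<in> A"
      by (rule comb[OF subsetD[OF interior_of_subset gw]])
    moreover have "(\<lambda>i\<in>{..<d}. (1 - t) * x i + t * ?g w i) = w"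
    proof -
      have "w \<in> extensional {..<d}" using w by (simp add: PiE_def)
      then show ?thesis using t(1) by (intro extensionalityI[of _ "{..<d}"]) simp_all
    qed
    ultimately show "w \<in> A" by simp
  qed
  ultimately have "?V \<subseteq> ?U" by (intro interior_of_maximal)
  moreover have "(\<lambda>i\<in>{..<d}. (1 - t) * x i + t * p i) \<in> ?V"
  proof -
    have "?g (\<lambda>i\<in>{..<d}. (1 - t) * x i + t * p i) = p"
    proof -
      have "p \<in> extensional {..<d}"
        using p interior_of_subset_topspace[of "space_top d" A] by (auto simp: PiE_def)
      then show ?thesis using t(1) by (intro extensionalityI[of _ "{..<d}"]) simp_all
    qed
    then have "?g (\<lambda>i\<in>{..<d}. (1 - t) * x i + t * p i) \<in> ?U" using p by (simp only:)
    moreover have "(\<lambda>i\<in>{..<d}. (1 - t) * x i + t * p i) \<in> topspace (space_top d)" by simp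
    ultimately show ?thesis by (simp only: mem_Collect_eq simp_thms)
  qed
  ultimately show ?thesis by (rule subsetD)
qed

text \<open>
  If the hyperplane orthogonal to \<open>u\<close> misses the interior of \<open>A\<close>, then all of \<open>A\<close>, including its
  boundary, lies on the closed side of an interior point \<open>p\<close>: otherwise the segment from \<open>p\<close> to a point on
  the other side would cross the hyperplane in the interior.
\<close>

lemma convex_in_halfspace:
  assumes A: "convex_in d A" and p: "p \<in> space_top d interior_of A" and x: "x \<in> A"
    and nz: "\<And>z. z \<in> space_top d interior_of A \<Longrightarrow> (\<Sum>i<d. u i * z i) \<noteq> 0"
    and neg: "(\<Sum>i<d. u i * p i) < 0"
  shows "(\<Sum>i<d. u i * x i) \<le> (0::real)"
proof (rule ccontr)
  define a b where "a = (\<Sum>i<d. u i * x i)" and "b = (\<Sum>i<d. u i * p i)"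
  assume "\<not> (\<Sum>i<d. u i * x i) \<le> 0"
  then have ab: "0 < a" "b < 0" using neg by (auto simp: a_def b_def)
  \<comment> \<open>The parameter at which the segment from \<open>x\<close> to \<open>p\<close> meets the hyperplane.\<close>
  define t where "t = a / (a - b)"
  have t: "0 < t" "t \<le> 1" using ab by (auto simp: t_def)
  let ?z = "\<lambda>i\<in>{..<d}. (1 - t) * x i + t * p i"
  have "(\<Sum>i<d. u i * ?z i) = (1 - t) * a + t * b"
    unfolding a_def b_def sum_distrib_left sum.distrib[symmetric]
    by (intro sum.cong) (auto simp: algebra_simps)
  also have "\<dots> = 0" using ab by (simp add: t_def field_simps)
  finally show False using nz[OF convex_in_segment_interior[OF A x p t]] by simp
qed

lemma avoids_imp_polar_cone:
  assumes A: "convex_in d A" "space_top d interior_of A \<noteq> {}" and u: "u \<in> topspace (space_top d)"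
    and av: "avoids d {x \<in> topspace (space_top d). (\<Sum>i<d. u i * x i) = 0} A"
  shows "u \<in> polar_cone d A \<or> (\<lambda>i\<in>{..<d}. - u i) \<in> polar_cone d A"
proof -
  obtain p where p: "p \<in> space_top d interior_of A" using A(2) by blast
  have nz: "(\<Sum>i<d. u i * z i) \<noteq> 0" if "z \<in> space_top d interior_of A" for z
    using av that interior_of_subset_topspace[of "space_top d" A] unfolding avoids_def by blast
  have eq: "(\<Sum>i<d. (\<lambda>i\<in>{..<d}. - u i) i * z i) = - (\<Sum>i<d. u i * z i)" for z
    by (simp add: sum_negf[symmetric])
  show ?thesis
  proof (cases "(\<Sum>i<d. u i * p i) < 0")
    case True
    then show ?thesis using convex_in_halfspace[OF A(1) p _ nz] u by (auto simp: polar_cone_def)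
  next
    case False
    then have "(\<Sum>i<d. (\<lambda>i\<in>{..<d}. - u i) i * p i) < 0" using nz[OF p] unfolding eq by simp
    then have "(\<Sum>i<d. (\<lambda>i\<in>{..<d}. - u i) i * x i) \<le> 0" if "x \<in> A" for x
      using nz by (intro convex_in_halfspace[OF A(1) p that]) (simp_all only: eq neg_equal_0_iff_equal simp_thms)
    then show ?thesis unfolding polar_cone_def by simp
  qed
qed

section \<open>The lower bound\<close>

text \<open>
  The counting argument for \<open>n\<close> parts of common Gaussian measure \<open>m\<close>. The bound \<open>n * m \<ge> 1\<close> is
  subadditivity over the parts, which may overlap in their boundaries.
\<close>

lemma avoidable_parts_imp_le:
  assumes "0 < n" "avoidable_parts d 1 n"
  shows "2 ^ d \<le> 2 * (real n)\<^sup>2"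
proof -
  let ?g = "emeasure (std_gaussian d)" and ?X = "topspace (space_top d)"
  let ?neg = "\<lambda>B. {u \<in> ?X. (\<lambda>i\<in>{..<d}. - u i) \<in> B}"
  obtain P where P: "convex_partition d n P" and eq: "\<And>A B. A \<in> P \<Longrightarrow> B \<in> P \<Longrightarrow> ?g A = ?g B"
    and hyp: "\<And>H. hyperplane d H \<Longrightarrow> 1 \<le> card {A \<in> P. avoids d H A}"
    using assms(2) nice_measure_std_gaussian[of d] unfolding avoidable_parts_def by meson
  have fin: "finite P" and card: "card P = n" and cover: "\<Union>P = ?X"
    using P by (auto simp: convex_partition_def)
  have cl: "closedin (space_top d) A" and cvx: "convex_in d A" and int: "space_top d interior_of A \<noteq> {}"
    if "A \<in> P" for A
    using P that by (auto simp: convex_partition_def)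
  have meas: "A \<in> sets (std_gaussian d)" if "A \<in> P" for A
    using closedin_space_top_measurable[OF cl[OF that]] by (simp only: sets_std_gaussian)
  have polar_meas: "polar_cone d A \<in> sets (std_gaussian d)" "?neg (polar_cone d A) \<in> sets (std_gaussian d)" for A
    unfolding sets_std_gaussian by (intro polar_cone_measurable emeasure_std_gaussian_uminus)+
  obtain A0 where A0: "A0 \<in> P" using card assms(1) by fastforce
  define m where "m = ?g A0"
  have m: "?g A = m" if "A \<in> P" for A using eq[OF that A0] by (simp add: m_def)
  have directions: "?X \<subseteq> (\<Union>A\<in>P. polar_cone d A \<union> ?neg (polar_cone d A))"
  proof
    fix u assume u: "u \<in> ?X"
    have "\<exists>A\<in>P. u \<in> polar_cone d A \<or> (\<lambda>i\<in>{..<d}. - u i) \<in> polar_cone d A"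
    proof (cases "\<exists>i<d. u i \<noteq> 0")
      case True
      then have "hyperplane d {x \<in> ?X. (\<Sum>i<d. u i * x i) = 0}" unfolding hyperplane_def by blast
      from hyp[OF this] have "{A \<in> P. avoids d {x \<in> ?X. (\<Sum>i<d. u i * x i) = 0} A} \<noteq> {}"
        by (metis card.empty not_one_le_zero)
      then show ?thesis using avoids_imp_polar_cone[OF cvx int u] by blast
    next
      case False
      \<comment> \<open>There is no hyperplane orthogonal to \<open>0\<close>, but \<open>0\<close> lies in every polar cone.\<close>
      then have "(\<Sum>i<d. u i * x i) = 0" for x by (intro sum.neutral) auto
      then have "u \<in> polar_cone d A0" using u by (simp add: polar_cone_def)
      then show ?thesis using A0 by blast
    qed
    then show "u \<in> (\<Union>A\<in>P. polar_cone d A \<union> ?neg (polar_cone d A))" using u by blast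
  qed
  have nm: "1 \<le> of_nat n * m"
  proof -
    have "1 = ?g (\<Union>A\<in>P. A)" using cover by (simp only: emeasure_space_std_gaussian image_ident)
    also have "\<dots> \<le> (\<Sum>A\<in>P. ?g A)"
      using fin meas by (intro emeasure_subadditive_finite) auto
    also have "\<dots> = of_nat n * m" using m card by simp
    finally show ?thesis .
  qed
  have "1 = ?g ?X" by (simp only: emeasure_space_std_gaussian)
  also have "\<dots> \<le> ?g (\<Union>A\<in>P. polar_cone d A \<union> ?neg (polar_cone d A))"
    using fin polar_meas by (intro emeasure_mono directions sets.finite_UN sets.Un)
  also have "\<dots> \<le> (\<Sum>A\<in>P. ?g (polar_cone d A \<union> ?neg (polar_cone d A)))"
    using fin polar_meas by (intro emeasure_subadditive_finite image_subsetI sets.Un)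
  also have "\<dots> \<le> (\<Sum>A\<in>P. ?g (polar_cone d A) + ?g (?neg (polar_cone d A)))"
    using polar_meas by (intro sum_mono emeasure_subadditive)
  also have "\<dots> = (\<Sum>A\<in>P. 2 * ?g (polar_cone d A))"
    by (intro sum.cong refl) (simp only: emeasure_std_gaussian_uminus(2)[OF polar_cone_measurable] mult_2)
  finally have "m * 1 \<le> m * (\<Sum>A\<in>P. 2 * ?g (polar_cone d A))"
    by (rule mult_left_mono) simp
  also have "\<dots> = (\<Sum>A\<in>P. 2 * (?g A * ?g (polar_cone d A)))"
    unfolding sum_distrib_left by (intro sum.cong) (simp_all add: m ac_simps)
  also have "\<dots> \<le> (\<Sum>A\<in>P. 2 * ennreal ((1 / 2) ^ d))"
    using meas unfolding sets_std_gaussian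
    by (intro sum_mono mult_left_mono std_gaussian_polar_cone_le) auto
  also have "\<dots> = of_nat n * (2 * ennreal ((1 / 2) ^ d))" using card by simp
  finally have "of_nat n * m \<le> of_nat n * (of_nat n * (2 * ennreal ((1 / 2) ^ d)))"
    by (intro mult_left_mono) auto
  with nm have "1 \<le> of_nat n * (of_nat n * (2 * ennreal ((1 / 2) ^ d)))" by (rule order_trans)
  also have "\<dots> = ennreal (real n * (real n * (2 * (1 / 2) ^ d)))"
    by (simp only: ennreal_of_nat_eq_real_of_nat ennreal_numeral[symmetric] ennreal_mult
        zero_le_mult_iff of_nat_0_le_iff zero_le_numeral zero_le_power zero_le_divide_1_iff simp_thms)
  finally have "1 \<le> real n * (real n * (2 * (1 / 2) ^ d))"
    by (simp only: ennreal_1[symmetric] ennreal_le_iff mult_nonneg_nonneg of_nat_0_le_iff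
        zero_le_numeral zero_le_power zero_le_divide_1_iff)
  then show ?thesis by (simp add: power_divide power2_eq_square field_simps)
qed

theorem corollary6:
  shows "\<exists>C::real. 0 < C \<and>
           (\<forall>d::nat. 1 \<le> d \<longrightarrow> ereal (C * 2 powr (real d / 2)) \<le> ereal_of_enat (min_parts d 1))"
proof (intro exI[of _ "1 / sqrt 2"] conjI allI impI)
  fix d :: nat
  show "ereal (1 / sqrt 2 * 2 powr (real d / 2)) \<le> ereal_of_enat (min_parts d 1)"
  proof (cases "{enat n | n. 0 < n \<and> avoidable_parts d 1 n} = {}")
    case True
    then have "min_parts d 1 = \<infinity>" unfolding min_parts_def by (simp only: Inf_enat_def simp_thms if_True)
    then show ?thesis by simp
  next
    case False
    then have "min_parts d 1 \<in> {enat n | n. 0 < n \<and> avoidable_parts d 1 n}"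
      unfolding min_parts_def Inf_enat_def by (auto intro: LeastI)
    then obtain n where n: "min_parts d 1 = enat n" "0 < n" "avoidable_parts d 1 n" by blast
    have "(2 powr (real d / 2))\<^sup>2 = 2 ^ d"
      by (simp add: powr_power powr_realpow)
    also have "\<dots> \<le> 2 * (real n)\<^sup>2" by (rule avoidable_parts_imp_le[OF n(2,3)])
    also have "\<dots> = (sqrt 2 * real n)\<^sup>2" by (simp add: power_mult_distrib)
    finally have "2 powr (real d / 2) \<le> sqrt 2 * real n" by (rule power2_le_imp_le) simp
    then have "1 / sqrt 2 * 2 powr (real d / 2) \<le> real n" by (simp add: field_simps)
    then show ?thesis unfolding n(1) by simp
  qed
qed simp

end
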